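(* Let $n\ge 1$ and let $(x_1,y_1),\dots,(x_n,y_n)$ be data points with $x_i,y_i>0$ for all $i$, and such that for all $i\neq j$, $(x_i,y_i)\neq(x_j,y_j)$ and $(x_i,y_i)\neq(y_j,x_j)$. Put $g_i(\theta)=x_iy_i\theta^2+(x_i+y_i-1)\theta+1$. If no two polynomials $g_i,g_j$ with $i\neq j$ have a common complex zero, and exactly $n_1$ ($\le n$) of the $g_i$ have a double zero, then the ML-degree of the association parameter $\theta$ in GBED($\theta$) for these data is $2n-n_1$.
   Context: GBED($\theta$) is Gumbel's Type-I bivariate exponential distribution with association parameter $\theta\in[0,1]$, with density $e^{-(x+y+\theta xy)}[(1+\theta x)(1+\theta y)-\theta]$ on the first quadrant. For data $(x_i,y_i)$, $i=1,\dots,n$, put $c_i=x_iy_i$, $d_i=x_i+y_i-1$, $$f_i(\theta)=c_i^2\theta^2+c_i(d_i-2)\theta+(c_i-d_i),\qquad g_i(\theta)=c_i\theta^2+d_i\theta+1,$$ $$f(\theta)=\sum_{i=1}^n f_i(\theta)\prod_{j\neq i}g_j(\theta),\qquad g(\theta)=\prod_{i=1}^n g_i(\theta).$$ The score equation is $\sum_{i=1}^n f_i(\theta)/g_i(\theta)=0$, i.e. $f(\theta)/g(\theta)=0$. The ML-degree of $\theta$ for the given data is the number of solutions of the score equation over $\mathbb{C}$ counted with multiplicity, that is, the number of complex zeros of $f$ that are not zeros of $g$, each counted with its multiplicity as a zero of $f$. *)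

theory Defs
  imports Complex_Main "HOL-Computational_Algebra.Polynomial"
begin

definition gbed_density :: "real \<Rightarrow> real \<Rightarrow> real \<Rightarrow> real" where
  "gbed_density \<theta> x y =
     (if x > 0 \<and> y > 0
      then exp (- (x + y + \<theta> * x * y)) * ((1 + \<theta> * x) * (1 + \<theta> * y) - \<theta>)
      else 0)"

text \<open>The data are real, but all polynomials are taken over the complex numbers, since the
  score equation is to be solved there.  A sample of size n is a pair of functions x, y, of
  which only the values at the indices 1, ..., n matter.\<close>

definition gbed_c :: "real \<Rightarrow> real \<Rightarrow> real" where
  "gbed_c x y = x * y"

definition gbed_d :: "real \<Rightarrow> real \<Rightarrow> real" where
  "gbed_d x y = x + y - 1"

definition gbed_fi :: "real \<Rightarrow> real \<Rightarrow> complex poly" where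
  "gbed_fi x y =
     [: of_real (gbed_c x y - gbed_d x y),
        of_real (gbed_c x y * (gbed_d x y - 2)),
        of_real ((gbed_c x y)\<^sup>2) :]"

definition gbed_gi :: "real \<Rightarrow> real \<Rightarrow> complex poly" where
  "gbed_gi x y = [: 1, of_real (gbed_d x y), of_real (gbed_c x y) :]"

definition gbed_f :: "nat \<Rightarrow> (nat \<Rightarrow> real) \<Rightarrow> (nat \<Rightarrow> real) \<Rightarrow> complex poly" where
  "gbed_f n x y =
     (\<Sum>i\<in>{1..n}. gbed_fi (x i) (y i) * (\<Prod>j\<in>{1..n} - {i}. gbed_gi (x j) (y j)))"

definition gbed_g :: "nat \<Rightarrow> (nat \<Rightarrow> real) \<Rightarrow> (nat \<Rightarrow> real) \<Rightarrow> complex poly" where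
  "gbed_g n x y = (\<Prod>i\<in>{1..n}. gbed_gi (x i) (y i))"

text \<open>The index set of the sum is finite because f is not the zero polynomial: for positive
  data and n at least 1 its coefficient of degree 2n is
  \<open>(\<Prod>i. c\<^sub>i) * (\<Sum>i. c\<^sub>i) > 0\<close>.\<close>

definition gbed_ml_degree :: "nat \<Rightarrow> (nat \<Rightarrow> real) \<Rightarrow> (nat \<Rightarrow> real) \<Rightarrow> nat" where
  "gbed_ml_degree n x y =
     (\<Sum>z \<in> {z. poly (gbed_f n x y) z = 0 \<and> poly (gbed_g n x y) z \<noteq> 0}.
        order z (gbed_f n x y))"

text \<open>The derivative of the log-likelihood is the negative of the left-hand side of the score
  equation.\<close>

lemma gbed_score:
  assumes pos: "\<And>i. i \<in> {1..n} \<Longrightarrow> x i > 0 \<and> y i > 0" and "0 \<le> \<theta>" "\<theta> \<le> 1"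
  shows "\<exists>D. ((\<lambda>t. \<Sum>i\<in>{1..n}. ln (gbed_density t (x i) (y i))) has_real_derivative D) (at \<theta>) \<and>
    complex_of_real D =
      - (\<Sum>i\<in>{1..n}. poly (gbed_fi (x i) (y i)) (of_real \<theta>) / poly (gbed_gi (x i) (y i)) (of_real \<theta>))"
proof -
  define F where "F a b = (a*b)\<^sup>2 * \<theta>\<^sup>2 + a*b * (a + b - 3) * \<theta> + (a*b - (a + b - 1))" for a b :: real
  define G where "G a b = a*b * \<theta>\<^sup>2 + (a + b - 1) * \<theta> + 1" for a b :: real
  have *: "((\<lambda>t. ln (gbed_density t a b)) has_real_derivative - (F a b / G a b)) (at \<theta>)"
    if "a > 0" "b > 0" for a b
  proof -
    have eq: "(1 + \<theta>*a) * (1 + \<theta>*b) - \<theta> = G a b"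
      by (simp add: G_def algebra_simps power2_eq_square)
    have "G a b = (1 - \<theta>) + \<theta> * (a + b) + a * b * \<theta>\<^sup>2"
      by (simp add: G_def algebra_simps)
    moreover have "\<theta> * (a + b) \<ge> 0" "a * b * \<theta>\<^sup>2 \<ge> 0" "\<theta> > 0 \<Longrightarrow> \<theta> * (a + b) > 0"
      using that assms by auto
    ultimately have G: "G a b > 0"
      using assms by (cases "\<theta> = 0") auto
    have "((\<lambda>t. ln (gbed_density t a b)) has_real_derivative
        (exp (- (a + b + \<theta>*a*b)) * (- (a*b)) * G a b
          + exp (- (a + b + \<theta>*a*b)) * (a * (1 + \<theta>*b) + (1 + \<theta>*a) * b - 1))
        / (exp (- (a + b + \<theta>*a*b)) * G a b)) (at \<theta>)"
      unfolding gbed_density_def using that G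
      by (auto intro!: derivative_eq_intros simp: eq[symmetric])
    also have "(exp (- (a + b + \<theta>*a*b)) * (- (a*b)) * G a b
          + exp (- (a + b + \<theta>*a*b)) * (a * (1 + \<theta>*b) + (1 + \<theta>*a) * b - 1))
        / (exp (- (a + b + \<theta>*a*b)) * G a b)
      = (- (a*b) * G a b + (a * (1 + \<theta>*b) + (1 + \<theta>*a) * b - 1)) / G a b"
      using G by (simp add: field_simps)
    also have "- (a*b) * G a b + (a * (1 + \<theta>*b) + (1 + \<theta>*a) * b - 1) = - F a b"
      by (simp add: F_def G_def algebra_simps power2_eq_square)
    finally show ?thesis by simp
  qed
  have "((\<lambda>t. \<Sum>i\<in>{1..n}. ln (gbed_density t (x i) (y i))) has_real_derivative
      (\<Sum>i\<in>{1..n}. - (F (x i) (y i) / G (x i) (y i)))) (at \<theta>)"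
    using pos by (intro DERIV_sum *) auto
  moreover have "poly (gbed_fi a b) (of_real \<theta>) = of_real (F a b)"
    and "poly (gbed_gi a b) (of_real \<theta>) = of_real (G a b)" for a b
    by (simp_all add: F_def G_def gbed_fi_def gbed_gi_def gbed_c_def gbed_d_def
        algebra_simps power2_eq_square)
  ultimately show ?thesis
    by (intro exI[of _ "\<Sum>i\<in>{1..n}. - (F (x i) (y i) / G (x i) (y i))"])
       (simp add: sum_negf)
qed

end

theory Submission
  imports Defs "HOL-Computational_Algebra.Fundamental_Theorem_Algebra"
begin

text \<open>
  Since \<open>f\<^sub>i = c\<^sub>i g\<^sub>i - g\<^sub>i'\<close>, the score is a constant minus a logarithmic derivative:
  \<open>f = C g - g'\<close> with \<open>C = \<Sum>i. c\<^sub>i > 0\<close>.  Hence \<open>f\<close> has the same degree as \<open>g\<close>, and at a zero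
  of \<open>g\<close> of order \<open>k\<close> the summand \<open>g'\<close> dominates, so that \<open>f\<close> vanishes there to order exactly
  \<open>k - 1\<close>.  Comparing the total number of zeros of \<open>f\<close> and of \<open>g\<close>, each distinct zero of \<open>g\<close> leaves
  room for exactly one zero of \<open>f\<close> elsewhere
  (\<open>sum_order_smult_minus_pderiv_off_roots\<close>).  So the ML-degree is the number of distinct zeros
  of \<open>g\<close>.  Each \<open>g\<^sub>i\<close> is a genuine quadratic and contributes one or two of them, according to
  whether it has a double zero; no zero is counted twice as the \<open>g\<^sub>i\<close> have none in common.
\<close>

lemma sum_order_eq_degree:
  fixes p :: "complex poly"
  assumes "p \<noteq> 0"
  shows "(\<Sum>z | poly p z = 0. order z p) = degree p"
  using size_proots_complex[of p] assms by (simp add: size_multiset_overloaded_eq)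

text \<open>Passing from \<open>p\<close> to \<open>p'\<close> lowers the order of a zero by one, while \<open>smult c p\<close> vanishes to
  at least the full order and so cannot cancel the leading term of \<open>p'\<close> there.\<close>

lemma order_smult_minus_pderiv:
  fixes p :: "'a::field_char_0 poly"
  assumes "p \<noteq> 0" "poly p z = 0"
  shows "Suc (order z (smult c p - pderiv p)) = order z p"
proof -
  define k where "k = order z (pderiv p)"
  have k: "order z p = Suc k"
    using order_pderiv[OF assms] by (simp add: k_def)
  have "degree p \<noteq> 0"
    using assms by (metis degree_eq_zeroE pCons_0_0 poly_const_conv)
  then have "pderiv p \<noteq> 0"
    by (simp add: pderiv_eq_0_iff)
  then have 1: "[:-z, 1:] ^ k dvd pderiv p" "\<not> [:-z, 1:] ^ Suc k dvd pderiv p"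
    unfolding order_divides by (simp_all add: k_def)
  have 2: "[:-z, 1:] ^ Suc k dvd smult c p"
    unfolding k[symmetric] by (intro dvd_smult order_1)
  then have "[:-z, 1:] ^ k dvd smult c p"
    by (rule power_le_dvd) simp
  with 1 have "[:-z, 1:] ^ k dvd smult c p - pderiv p"
    by (intro dvd_diff)
  moreover have "\<not> [:-z, 1:] ^ Suc k dvd smult c p - pderiv p"
    using 1 2 dvd_diff_right_iff[of "[:-z, 1:] ^ Suc k" "smult c p" "pderiv p"] by blast
  ultimately show ?thesis
    unfolding k by (subst order_unique_lemma) auto
qed

lemma degree_smult_minus_pderiv:
  fixes p :: "'a::field_char_0 poly"
  assumes "c \<noteq> 0" "p \<noteq> 0"
  shows "degree (smult c p - pderiv p) = degree p" "smult c p - pderiv p \<noteq> 0"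
proof -
  have "coeff (smult c p - pderiv p) (degree p) = c * lead_coeff p"
    by (simp add: coeff_pderiv coeff_eq_0)
  then have "coeff (smult c p - pderiv p) (degree p) \<noteq> 0"
    using assms by simp
  moreover from this show "smult c p - pderiv p \<noteq> 0"
    by (metis coeff_0)
  moreover have "degree (smult c p - pderiv p) \<le> degree p"
    by (intro degree_diff_le) (auto simp: degree_pderiv)
  ultimately show "degree (smult c p - pderiv p) = degree p"
    using le_degree le_antisym by blast
qed

text \<open>Both \<open>p\<close> and \<open>smult c p - pderiv p\<close> have \<open>degree p\<close> zeros in all, and at each distinct zero
  of \<open>p\<close> the latter has exactly one fewer; these missing zeros must lie elsewhere.\<close>

lemma sum_order_smult_minus_pderiv_off_roots:
  fixes p :: "complex poly"
  assumes "c \<noteq> 0" "p \<noteq> 0"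
  defines "q \<equiv> smult c p - pderiv p"
  shows "(\<Sum>z | poly q z = 0 \<and> poly p z \<noteq> 0. order z q) = card {z. poly p z = 0}"
proof -
  let ?Z = "{z. poly p z = 0}"
  let ?off = "\<Sum>z | poly q z = 0 \<and> poly p z \<noteq> 0. order z q"
  have q: "q \<noteq> 0" "degree q = degree p"
    using degree_smult_minus_pderiv[OF assms(1,2)] by (simp_all add: q_def)
  have fin: "finite ?Z" "finite {z. poly q z = 0}"
    using assms(2) q(1) by (simp_all add: poly_roots_finite)
  have on: "(\<Sum>z\<in>?Z. order z q) + card ?Z = degree p"
  proof -
    have "(\<Sum>z\<in>?Z. order z q) + card ?Z = (\<Sum>z\<in>?Z. Suc (order z q))"
      using sum_Suc[of "\<lambda>z. order z q" ?Z] by simp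
    also have "\<dots> = (\<Sum>z\<in>?Z. order z p)"
      using assms(2) by (intro sum.cong) (auto simp: q_def order_smult_minus_pderiv)
    finally show ?thesis
      using sum_order_eq_degree[OF assms(2)] by simp
  qed
  have "degree p = (\<Sum>z | poly q z = 0. order z q)"
    using sum_order_eq_degree[OF q(1)] q(2) by simp
  \<comment> \<open>Simple zeros of \<open>p\<close> are not zeros of \<open>q\<close>; including them adds only orders 0.\<close>
  also have "\<dots> = (\<Sum>z \<in> ?Z \<union> {z. poly q z = 0 \<and> poly p z \<noteq> 0}. order z q)"
    using fin by (intro sum.mono_neutral_left) (auto simp: order_root)
  also have "\<dots> = (\<Sum>z\<in>?Z. order z q) + ?off"
    using fin by (intro sum.union_disjoint) auto
  finally show ?thesis
    using on by simp
qed

lemma card_roots_degree_2: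
  fixes p :: "complex poly"
  assumes "degree p = 2"
  shows "card {z. poly p z = 0} = (if \<exists>z. order z p = 2 then 1 else 2)"
proof -
  let ?Z = "{z. poly p z = 0}"
  have p: "p \<noteq> 0" using assms by auto
  then have fin: "finite ?Z" by (simp add: poly_roots_finite)
  have sum: "(\<Sum>z\<in>?Z. order z p) = 2"
    using sum_order_eq_degree[OF p] assms by simp
  have pos: "order z p \<noteq> 0" if "z \<in> ?Z" for z
    using that p by (simp add: order_root)
  show ?thesis
  proof (cases "\<exists>z. order z p = 2")
    case True
    then obtain z where z: "order z p = 2" by blast
    then have "z \<in> ?Z" using p by (simp add: order_root)
    then have "(\<Sum>w\<in>?Z - {z}. order w p) = 0"
      using sum z fin sum.remove[of ?Z z "\<lambda>w. order w p"] by simp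
    then have "\<forall>w \<in> ?Z - {z}. order w p = 0"
      using fin by (subst (asm) sum_eq_0_iff) simp_all
    then have "?Z = {z}"
      using pos \<open>z \<in> ?Z\<close> by blast
    then show ?thesis using True by simp
  next
    case False
    have "order z p = 1" if "z \<in> ?Z" for z
    proof -
      have "order z p \<noteq> 2" using False by blast
      with pos[OF that] order_degree[OF p, of z] show ?thesis
        unfolding assms by linarith
    qed
    then have "(\<Sum>z\<in>?Z. order z p) = card ?Z" by simp
    then show ?thesis using sum False by simp
  qed
qed

lemma gbed_fi_eq:
  "gbed_fi a b = smult (of_real (a * b)) (gbed_gi a b) - pderiv (gbed_gi a b)"
  by (simp add: gbed_fi_def gbed_gi_def gbed_c_def gbed_d_def pderiv_pCons
      algebra_simps power2_eq_square)

text \<open>The identity for the single \<open>f\<^sub>i\<close> passes to the whole sample because, by the product rule,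
  logarithmic derivatives add.\<close>

lemma gbed_f_eq:
  "gbed_f n x y = smult (of_real (\<Sum>i=1..n. x i * y i)) (gbed_g n x y) - pderiv (gbed_g n x y)"
proof -
  let ?c = "\<lambda>i. complex_of_real (x i * y i)" and ?g = "\<lambda>i. gbed_gi (x i) (y i)"
  have "gbed_f n x y =
    (\<Sum>i\<in>{1..n}. smult (?c i) (gbed_g n x y) - prod ?g ({1..n} - {i}) * pderiv (?g i))"
    unfolding gbed_f_def
  proof (rule sum.cong)
    fix i assume "i \<in> {1..n}"
    then have "gbed_g n x y = ?g i * prod ?g ({1..n} - {i})"
      unfolding gbed_g_def by (intro prod.remove) auto
    then show "gbed_fi (x i) (y i) * prod ?g ({1..n} - {i}) =
        smult (?c i) (gbed_g n x y) - prod ?g ({1..n} - {i}) * pderiv (?g i)"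
      by (simp add: gbed_fi_eq algebra_simps)
  qed simp
  also have "\<dots> = smult (\<Sum>i=1..n. ?c i) (gbed_g n x y) - pderiv (gbed_g n x y)"
    by (simp add: sum_subtractf smult_sum gbed_g_def pderiv_prod)
  finally show ?thesis by simp
qed

theorem theorem5p3:
  fixes n n\<^sub>1 :: nat and x y :: "nat \<Rightarrow> real"
  assumes "n \<ge> 1"
    and "\<And>i. i \<in> {1..n} \<Longrightarrow> x i > 0 \<and> y i > 0"
    and "\<And>i j. i \<in> {1..n} \<Longrightarrow> j \<in> {1..n} \<Longrightarrow> i \<noteq> j \<Longrightarrow>
           (x i, y i) \<noteq> (x j, y j) \<and> (x i, y i) \<noteq> (y j, x j)"
    and "\<And>i j. i \<in> {1..n} \<Longrightarrow> j \<in> {1..n} \<Longrightarrow> i \<noteq> j \<Longrightarrow>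
           \<not> (\<exists>z. poly (gbed_gi (x i) (y i)) z = 0 \<and> poly (gbed_gi (x j) (y j)) z = 0)"
    and "card {i \<in> {1..n}. \<exists>z. order z (gbed_gi (x i) (y i)) = 2} = n\<^sub>1"
  shows "gbed_ml_degree n x y = 2 * n - n\<^sub>1"
proof -
  let ?g = "\<lambda>i. gbed_gi (x i) (y i)"
  let ?dbl = "\<lambda>i. \<exists>z. order z (?g i) = 2"
  have deg: "degree (?g i) = 2" if "i \<in> {1..n}" for i
    using assms(2)[OF that] by (simp add: gbed_gi_def gbed_c_def)
  then have g_nz: "?g i \<noteq> 0" if "i \<in> {1..n}" for i
    using that by fastforce
  then have g: "gbed_g n x y \<noteq> 0"
    by (simp add: gbed_g_def)
  have "(\<Sum>i=1..n. x i * y i) > 0"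
    using assms(1,2) by (intro sum_pos) auto
  then have "complex_of_real (\<Sum>i=1..n. x i * y i) \<noteq> 0"
    by (metis of_real_eq_0_iff less_irrefl)
  from sum_order_smult_minus_pderiv_off_roots[OF this g]
  have "gbed_ml_degree n x y = card {z. poly (gbed_g n x y) z = 0}"
    unfolding gbed_ml_degree_def gbed_f_eq .
  also have "{z. poly (gbed_g n x y) z = 0} = (\<Union>i\<in>{1..n}. {z. poly (?g i) z = 0})"
    by (auto simp: gbed_g_def poly_prod)
  also have "card \<dots> = (\<Sum>i\<in>{1..n}. card {z. poly (?g i) z = 0})"
    using assms(4) g_nz by (intro card_UN_disjoint ballI impI) (auto simp: poly_roots_finite)
  also have "\<dots> = (\<Sum>i\<in>{1..n}. if ?dbl i then 1 else 2)"
    by (intro sum.cong) (simp_all add: card_roots_degree_2 deg)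
  also have "\<dots> = 2 * n - n\<^sub>1"
  proof -
    have "(\<Sum>i\<in>{1..n}. if ?dbl i then 1 else 2) + (\<Sum>i\<in>{1..n}. if ?dbl i then 1 else 0)
        = (\<Sum>i\<in>{1..n}. 2::nat)"
      unfolding sum.distrib[symmetric] by (intro sum.cong) auto
    also have "(\<Sum>i\<in>{1..n}. if ?dbl i then 1 else 0) = n\<^sub>1"
      unfolding assms(5)[symmetric] by (subst sum.inter_filter[symmetric]) auto
    finally show ?thesis by simp
  qed
  finally show ?thesis .
qed

end
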